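(* Let $n,k$ be positive integers and let $\mathcal{X} = \{x_1,\ldots,x_n\}$ be a set of $n$ real numbers whose sum is zero, indexed so that $x_i \geq x_j$ whenever $i \leq j$. If $n \geq 8k^2$, then at least $\binom{n-1}{k-1}$ of the $k$-element subsets of $\mathcal{X}$ have nonnegative sum. Moreover, if exactly $\binom{n-1}{k-1}$ of them have nonnegative sum, then the family of $k$-element subsets with nonnegative sum is exactly the family of all $k$-element subsets of $\mathcal{X}$ containing $x_1$. *)

theory Defs
  imports Complex_Main
begin

(* The n real numbers need not be distinct, as the non-strict ordering and the extremal
   example (n - 1, -1, ..., -1) suggest. They are therefore given as an indexed family
   x 1, ..., x n, and a k-element subset is represented by its set of indices, so that
   equal values at different indices are counted separately. If x is injective on {1..n},
   these are exactly the k-element subsets of the set of values. *)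

definition k_subsets :: "nat \<Rightarrow> nat \<Rightarrow> nat set set" where
  "k_subsets n k = {I. I \<subseteq> {1..n} \<and> card I = k}"

definition nonneg_k_subsets :: "(nat \<Rightarrow> real) \<Rightarrow> nat \<Rightarrow> nat \<Rightarrow> nat set set" where
  "nonneg_k_subsets x n k = {I \<in> k_subsets n k. 0 \<le> (\<Sum>i\<in>I. x i)}"

end

theory Submission
  imports Defs "HOL-Library.Ramsey"
begin

text \<open>
  Put \<open>N = n - 1 choose k - 1\<close>. If all \<open>k\<close>-sets containing \<open>x\<^sub>1\<close> are nonnegative, both claims
  are clear, so let \<open>B\<close> be a negative one. The complement of \<open>B\<close> has positive sum, and averaging
  over its partitions into \<open>k\<close>-sets gives more than \<open>3N/4\<close> nonnegative \<open>k\<close>-sets that avoid \<open>x\<^sub>1\<close>.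
  This suffices if at least \<open>N/4\<close> of the \<open>k\<close>-sets containing \<open>x\<^sub>1\<close> are nonnegative. Otherwise
  most \<open>(k - 1)\<close>-sets avoiding \<open>x\<^sub>1\<close> have sum below \<open>-x\<^sub>1\<close>. Since the sums average to nearly \<open>0\<close>,
  a fraction of order \<open>1/k\<close> of them exceed \<open>x\<^sub>1\<close>, and extending these by any of the at least
  roughly \<open>n/2\<close> elements of weight at least \<open>-x\<^sub>1\<close> produces more than \<open>N\<close> nonnegative \<open>k\<close>-sets.
\<close>

section \<open>Double counting of fixed-size subsets\<close>

definition nonneg_nsets :: "('a \<Rightarrow> real) \<Rightarrow> 'a set \<Rightarrow> nat \<Rightarrow> 'a set set" where
  "nonneg_nsets x A k = {S \<in> [A]\<^bsup>k\<^esup>. 0 \<le> sum x S}"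

lemma nsets_containing:
  assumes "finite A" "a \<in> A"
  shows "{S \<in> [A]\<^bsup>Suc j\<^esup>. a \<in> S} = insert a ` [A - {a}]\<^bsup>j\<^esup>"
proof (intro subset_antisym subsetI)
  fix S assume "S \<in> {S \<in> [A]\<^bsup>Suc j\<^esup>. a \<in> S}"
  then have "S = insert a (S - {a})" "S - {a} \<in> [A - {a}]\<^bsup>j\<^esup>"
    by (auto simp: nsets_def)
  then show "S \<in> insert a ` [A - {a}]\<^bsup>j\<^esup>"
    by blast
qed (use assms in \<open>auto simp: nsets_def card_insert_if\<close>)

lemma inj_on_insert_notin: "inj_on (insert a) {S. a \<notin> S}"
  by (auto simp: inj_on_def)

lemma card_nsets_containing:
  assumes "finite A" "a \<in> A"
  shows "card {S \<in> [A]\<^bsup>Suc j\<^esup>. a \<in> S} = (card A - 1 choose j)"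
proof -
  have "inj_on (insert a) ([A - {a}]\<^bsup>j\<^esup>)"
    by (rule inj_on_subset[OF inj_on_insert_notin]) (auto simp: nsets_def)
  then show ?thesis
    using assms by (simp add: nsets_containing card_image)
qed

lemma sum_nsets:
  fixes x :: "'a \<Rightarrow> real"
  assumes "finite A"
  shows "(\<Sum>S\<in>[A]\<^bsup>Suc j\<^esup>. sum x S) = (card A - 1 choose j) * sum x A"
proof -
  have "(\<Sum>S\<in>[A]\<^bsup>Suc j\<^esup>. sum x S) = (\<Sum>S\<in>[A]\<^bsup>Suc j\<^esup>. \<Sum>a\<in>{a\<in>A. a \<in> S}. x a)"
    by (intro sum.cong refl) (auto simp: nsets_def)
  also have "\<dots> = (\<Sum>a\<in>A. \<Sum>S\<in>{S\<in>[A]\<^bsup>Suc j\<^esup>. a \<in> S}. x a)"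
    using assms by (intro sum.swap_restrict finite_imp_finite_nsets)
  also have "\<dots> = (\<Sum>a\<in>A. (card A - 1 choose j) * x a)"
    using assms by (intro sum.cong) (simp_all add: card_nsets_containing)
  finally show ?thesis
    by (simp add: sum_distrib_left)
qed

text \<open>Pascal's rule applied \<open>d\<close> times; each application loses a term of at most
  \<open>m - 1 choose j\<close>.\<close>

lemma binomial_diff_bound:
  assumes "d \<le> m"
  shows "m choose Suc j \<le> (m - d choose Suc j) + d * (m - 1 choose j)"
  using assms
proof (induction d)
  case (Suc d)
  then have m: "m - d = Suc (m - Suc d)"
    by simp
  have "m - d choose Suc j = (m - Suc d choose Suc j) + (m - Suc d choose j)"
    unfolding m by simp
  moreover have "m - Suc d choose j \<le> m - 1 choose j"
    by (intro binomial_right_mono) simp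
  ultimately show ?case
    using Suc by simp
qed simp

section \<open>Nonnegative blocks in a set of nonnegative sum\<close>

text \<open>Discarding a minimal element keeps the sum nonnegative. This trims a set to a size
  divisible by \<open>k\<close>.\<close>

lemma exists_subset_sum_nonneg:
  fixes x :: "'a \<Rightarrow> real"
  assumes "finite A" "0 \<le> sum x A" "m \<le> card A"
  obtains B where "B \<subseteq> A" "card B = m" "0 \<le> sum x B"
proof -
  have "\<exists>B\<subseteq>A. card B = m \<and> 0 \<le> sum x B"
    using assms
  proof (induction "card A - m" arbitrary: A)
    case 0
    then show ?case
      by (intro exI[of _ A]) simp
  next
    case (Suc d)
    then have "A \<noteq> {}"
      by auto
    define a where "a = arg_min_on x A"
    have a: "a \<in> A" "\<And>b. b \<in> A \<Longrightarrow> x a \<le> x b"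
      unfolding a_def using Suc.prems \<open>A \<noteq> {}\<close>
      by (auto intro: arg_min_if_finite arg_min_least)
    have "0 \<le> sum x (A - {a})"
    proof (cases "0 \<le> x a")
      case True
      then show ?thesis
        using a(2) by (intro sum_nonneg) force
    next
      case False
      then show ?thesis
        using Suc.prems a(1) by (simp add: sum_diff1)
    qed
    moreover have "d = card (A - {a}) - m" "m \<le> card (A - {a})"
      using Suc.hyps(2) Suc.prems a(1) by auto
    ultimately obtain B where "B \<subseteq> A - {a}" "card B = m" "0 \<le> sum x B"
      using Suc.hyps(1)[of "A - {a}"] Suc.prems(1) by auto
    then show ?case
      by blast
  qed
  then show ?thesis
    using that by blast
qed

text \<open>
  This is what averaging over partitions of \<^term>\<open>A\<close> into blocks of size \<^term>\<open>k\<close> yields.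
  Counting disjoint pairs of a negative and a nonnegative block replaces the partitions
  by an induction on the number of blocks.
\<close>

lemma binomial_le_card_nonneg_nsets:
  fixes x :: "'a \<Rightarrow> real"
  assumes "finite A" "card A = q * k" "0 < q" "0 \<le> sum x A"
  shows "(q * k choose k) \<le> q * card (nonneg_nsets x A k)"
  using assms(3,1,2,4)
proof (induction q arbitrary: A rule: nat_induct_non_zero)
  case 1
  then have "A \<in> nonneg_nsets x A k" "finite (nonneg_nsets x A k)"
    by (auto simp: nonneg_nsets_def nsets_def)
  then have "0 < card (nonneg_nsets x A k)"
    by (auto simp: card_gt_0_iff)
  then show ?case
    by simp
next
  case (Suc q)
  define F where "F = nonneg_nsets x A k"
  define G where "G = [A]\<^bsup>k\<^esup> - F"
  have fin: "finite F" "finite G" "finite ([A]\<^bsup>k\<^esup>)"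
    using Suc.prems(1) by (auto simp: F_def G_def nonneg_nsets_def finite_imp_finite_nsets)
  define C where "C = (q * k choose k)"
  have "C > 0"
    using \<open>0 < q\<close> by (simp add: C_def)
  \<comment> \<open>Removing a negative block leaves \<open>q * k\<close> elements of positive sum,
    so the induction hypothesis applies to the complement.\<close>
  have low: "C \<le> q * card {S \<in> F. T \<inter> S = {}}" if "T \<in> G" for T
  proof -
    have T: "T \<subseteq> A" "card T = k" "sum x T < 0"
      using that by (auto simp: G_def F_def nonneg_nsets_def nsets_def)
    have "finite T"
      using T(1) Suc.prems(1) finite_subset by blast
    then have "card (A - T) = q * k" "0 \<le> sum x (A - T)"
      using T Suc.prems by (simp_all add: card_Diff_subset sum_diff)
    then have "C \<le> q * card (nonneg_nsets x (A - T) k)"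
      using Suc.IH Suc.prems(1) by (simp add: C_def)
    also have "nonneg_nsets x (A - T) k = {S \<in> F. T \<inter> S = {}}"
      by (auto simp: F_def nonneg_nsets_def nsets_def)
    finally show ?thesis .
  qed
  have up: "card {T \<in> G. T \<inter> S = {}} \<le> C" if "S \<in> F" for S
  proof -
    have S: "S \<subseteq> A" "card S = k" "finite S"
      using that by (auto simp: F_def nonneg_nsets_def nsets_def)
    have "card {T \<in> G. T \<inter> S = {}} \<le> card ([A - S]\<^bsup>k\<^esup>)"
      using Suc.prems(1)
      by (intro card_mono finite_imp_finite_nsets) (auto simp: G_def nsets_def)
    also have "\<dots> = C"
      using S Suc.prems by (simp add: card_Diff_subset C_def)
    finally show ?thesis .
  qed
  have "card G * C = (\<Sum>T\<in>G. C)"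
    by simp
  also have "\<dots> \<le> (\<Sum>T\<in>G. q * card {S \<in> F. T \<inter> S = {}})"
    by (intro sum_mono low)
  also have "\<dots> = q * (\<Sum>T\<in>G. card {S \<in> F. T \<inter> S = {}})"
    by (simp add: sum_distrib_left)
  also have "(\<Sum>T\<in>G. card {S \<in> F. T \<inter> S = {}}) = (\<Sum>S\<in>F. card {T \<in> G. T \<inter> S = {}})"
    using fin by (intro sum_multicount_gen) auto
  also have "\<dots> \<le> (\<Sum>S\<in>F. C)"
    by (intro sum_mono up)
  also have "q * \<dots> = q * card F * C"
    by simp
  \<comment> \<open>The same \<open>C\<close> arises on both sides of the double count and
    cancels.\<close>
  finally have "card G \<le> q * card F"
    using \<open>C > 0\<close> by simp
  moreover have "card ([A]\<^bsup>k\<^esup>) = card G + card F"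
    using fin card_Diff_subset[of F "[A]\<^bsup>k\<^esup>"] card_mono[of "[A]\<^bsup>k\<^esup>" F]
    by (auto simp: G_def F_def nonneg_nsets_def)
  ultimately show ?case
    using Suc.prems by (simp add: F_def)
qed

text \<open>Trim \<open>A\<close> to \<open>q * k\<close> elements; absorption turns
  \<open>(q * k choose k) / q\<close> into \<open>q * k - 1 choose (k - 1)\<close>.\<close>

lemma card_nonneg_nsets_ge:
  fixes x :: "'a \<Rightarrow> real"
  assumes "finite A" "0 \<le> sum x A" "k \<le> card A" "0 < k"
  shows "(card A - k choose (k - 1)) \<le> card (nonneg_nsets x A k)"
proof -
  define q where "q = card A div k"
  have "0 < q"
    using assms by (simp add: q_def div_greater_zero_iff)
  \<comment> \<open>Trimming removes at most \<open>k - 1\<close> elements, hence the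
    \<open>- 1\<close>.\<close>
  have q: "q * k \<le> card A" "card A - k \<le> q * k - 1"
    using mod_less_divisor[OF \<open>0 < k\<close>, of "card A"] div_mult_mod_eq[of "card A" k]
    unfolding q_def by linarith+
  obtain B where B: "B \<subseteq> A" "card B = q * k" "0 \<le> sum x B"
    using exists_subset_sum_nonneg[OF assms(1,2) q(1)] .
  have "finite B"
    using B(1) assms(1) finite_subset by blast
  have "q * k * (q * k - 1 choose (k - 1)) = k * (q * k choose k)"
    using binomial_absorption[of "k - 1" "q * k"] assms(4) by simp
  also have "\<dots> \<le> k * (q * card (nonneg_nsets x B k))"
    using binomial_le_card_nonneg_nsets[OF \<open>finite B\<close> B(2) \<open>0 < q\<close> B(3)] by simp
  finally have "(q * k - 1 choose (k - 1)) \<le> card (nonneg_nsets x B k)"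
    using \<open>0 < q\<close> \<open>0 < k\<close> by (simp add: mult.assoc mult.left_commute)
  moreover have "(card A - k choose (k - 1)) \<le> (q * k - 1 choose (k - 1))"
    using q(2) by (rule binomial_right_mono)
  moreover have "card (nonneg_nsets x B k) \<le> card (nonneg_nsets x A k)"
    using assms(1) B(1) nsets_mono[OF B(1), of k]
    by (intro card_mono) (auto simp: nonneg_nsets_def finite_imp_finite_nsets)
  ultimately show ?thesis
    by linarith
qed

section \<open>Numerical consequence of the quadratic bound on \<open>n\<close>\<close>

text \<open>Passing from \<open>n - 1\<close> to \<open>n - 2 * k\<close> loses at most a fraction
  \<open>(2 * k - 1) * (k - 1) / (n - 1)\<close> of the binomial coefficient, which is below
  1/4.\<close>

lemma binomial_shift_lower_bound:
  fixes n k :: nat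
  assumes "0 < k" "8 * k ^ 2 \<le> n"
  shows "3 * (n - 1 choose (k - 1)) < 4 * (n - 2 * k choose (k - 1))"
proof (cases "k = 1")
  case False
  then have k: "k = Suc (Suc (k - 2))"
    using assms(1) by simp
  then obtain j where k: "k = Suc (Suc j)"
    by blast
  define N where "N = (n - 1 choose Suc j)"
  have n: "8 * (j + 2) * (j + 2) \<le> n"
    using assms(2) by (simp add: k power2_eq_square algebra_simps)
  have le: "2 * j + 3 \<le> n - 1" "Suc j \<le> n - 1"
    using n by (auto simp: algebra_simps)
  have "N > 0"
    using le by (simp add: N_def)
  have "n - 1 - (2 * j + 3) = n - 2 * k"
    by (simp add: k)
  then have "N \<le> (n - 2 * k choose Suc j) + (2 * j + 3) * (n - 1 - 1 choose j)"
    using binomial_diff_bound[OF le(1), of j] unfolding N_def by simp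
  then have "(n - 1) * N \<le> (n - 1) * (n - 2 * k choose Suc j)
      + (2 * j + 3) * ((n - 1) * (n - 1 - 1 choose j))"
    by (metis (no_types, lifting) add_mult_distrib2 mult.left_commute mult_le_mono2)
  also have "(n - 1) * (n - 1 - 1 choose j) = Suc j * N"
    unfolding N_def using binomial_absorption[of j "n - 1"] by simp
  finally have 1: "(n - 1) * N \<le> (n - 1) * (n - 2 * k choose Suc j) + (2 * j + 3) * (Suc j * N)" .
  have "4 * ((2 * j + 3) * Suc j) < n - 1"
    using n by (simp add: algebra_simps)
  then have "4 * ((2 * j + 3) * Suc j) * N < (n - 1) * N"
    using \<open>N > 0\<close> by simp
  with 1 have "(n - 1) * (3 * N) < (n - 1) * (4 * (n - 2 * k choose Suc j))"
    by (simp add: algebra_simps)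
  then show ?thesis
    by (simp add: N_def k)
qed simp

section \<open>The case of few nonnegative sets through the largest element\<close>

text \<open>
  The sets of sum above \<^term>\<open>c\<close> must compensate for the majority of sets of sum below \<^term>\<open>-c\<close>.
  As no sum exceeds \<^term>\<open>c * t\<close>, they make up a fraction of order \<open>1 / t\<close>.
\<close>

lemma many_nonneg_nsets:
  fixes x :: "'a \<Rightarrow> real"
  assumes "finite A" "sum x A = - c" "0 < c" "\<And>a. a \<in> A \<Longrightarrow> x a \<le> c"
    and "0 < t" "8 * (t + 1) ^ 2 \<le> card A + 1"
    and few: "4 * card {T \<in> [A]\<^bsup>t\<^esup>. - c \<le> sum x T} < (card A choose t)"
  shows "(card A choose t) < card (nonneg_nsets x A (Suc t))"
proof -
  obtain j where t: "t = Suc j"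
    using \<open>0 < t\<close> gr0_conv_Suc by blast
  define m where "m = card A"
  define N where "N = (m choose t)"
  define G where "G = {T \<in> [A]\<^bsup>t\<^esup>. - c \<le> sum x T}"
  define H where "H = {T \<in> [A]\<^bsup>t\<^esup>. c < sum x T}"
  define F where "F = nonneg_nsets x A (Suc t)"
  define b where "b = card {a \<in> A. x a < - c}"
  have fin: "finite ([A]\<^bsup>t\<^esup>)" "finite G" "finite H" "finite F"
    using assms(1) by (auto simp: G_def H_def F_def nonneg_nsets_def finite_imp_finite_nsets)
  have m: "8 * (real t + 1) * (real t + 1) \<le> m + 1"
    using of_nat_mono[OF assms(6), where 'a=real] by (simp add: m_def power2_eq_square algebra_simps)
  have "N > 0"
    using few unfolding N_def m_def by linarith
  have absorb: "real m * (m - 1 choose j) = t * real N"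
    using binomial_absorption[of j m] unfolding t N_def
    by (metis of_nat_mult)
  \<comment> \<open>Since \<open>H\<close> lies in \<open>G\<close>, there are three ranges: sums
    below \<open>-c\<close> outside \<open>G\<close>, at most \<open>c\<close> in
    \<open>G - H\<close>, and at most \<open>c * t\<close> in \<open>H\<close>.\<close>
  have pointwise: "sum x T \<le>
      c * (2 * of_bool (T \<in> G) - 1) + c * (t * of_bool (T \<in> H))" if "T \<in> [A]\<^bsup>t\<^esup>" for T
  proof -
    have "sum x T \<le> (\<Sum>a\<in>T. c)"
      using that assms(4) by (intro sum_mono) (auto simp: nsets_def)
    then have "sum x T \<le> c * t"
      using that by (simp add: nsets_def mult.commute)
    then show ?thesis
      using that \<open>0 < c\<close> by (auto simp: G_def H_def)
  qed
  have ind: "(\<Sum>T\<in>[A]\<^bsup>t\<^esup>. of_bool (T \<in> K)) = real (card K)" if "K \<subseteq> [A]\<^bsup>t\<^esup>" for K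
    using that fin(1) by (simp add: Int_absorb1 Int_absorb2 Int_def[symmetric] of_bool_def sum.If_cases)
  have "- ((m - 1 choose j) * c) = (\<Sum>T\<in>[A]\<^bsup>t\<^esup>. sum x T)"
    using sum_nsets[OF assms(1), of x j] assms(2) by (simp add: t m_def)
  also have "\<dots> \<le> (\<Sum>T\<in>[A]\<^bsup>t\<^esup>. c * (2 * of_bool (T \<in> G) - 1) + c * (t * of_bool (T \<in> H)))"
    by (intro sum_mono pointwise)
  also have "\<dots> = c * (2 * real (card G) - real N + t * real (card H))"
    using ind[of G] ind[of H]
    by (simp add: sum.distrib sum_subtractf sum_distrib_left[symmetric] N_def m_def
        G_def H_def algebra_simps)
  finally have "c * (- real (m - 1 choose j)) \<le> c * (2 * real (card G) - real N + t * real (card H))"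
    by (simp add: mult.commute)
  then have avg: "real N - real (m - 1 choose j) - 2 * real (card G) \<le> t * real (card H)"
    unfolding mult_le_cancel_left_pos[OF \<open>0 < c\<close>] by simp
  have "real t \<le> real t * real t"
    using \<open>0 < t\<close> by simp
  moreover have "8 * (real t * real t) + 16 * real t + 7 \<le> m"
    using m by (simp add: algebra_simps)
  ultimately have "24 * real t \<le> m"
    by linarith
  then have "24 * real t * (m - 1 choose j) \<le> real m * (m - 1 choose j)"
    by (intro mult_right_mono) auto
  then have "real t * (24 * real (m - 1 choose j)) \<le> t * real N"
    using absorb by (simp add: mult_ac)
  then have "24 * real (m - 1 choose j) \<le> N"
    using \<open>0 < t\<close> by simp
  \<comment> \<open>The constant is 1 - 1/24 - 2/4 = 11/24: \<open>m - 1 choose j\<close> is at most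
    \<open>N / 24\<close>, and \<open>card G\<close> is below \<open>N / 4\<close>.\<close>
  then have H: "11 * real N \<le> 24 * (t * real (card H))"
    using avg few unfolding G_def N_def m_def by linarith

  \<comment> \<open>Elements below \<open>-c\<close> contribute less than \<open>-c\<close> each and
    all others at most \<open>c\<close>, while the total is \<open>-c\<close>.\<close>
  have b: "2 * real b \<le> m + 1"
  proof -
    have "- c = sum x A"
      using assms(2) by simp
    also have "\<dots> \<le> (\<Sum>a\<in>A. c * (1 - 2 * of_bool (x a < - c)))"
      using assms(3,4) by (intro sum_mono) auto
    also have "\<dots> = c * (m - 2 * real b)"
      using assms(1)
      by (simp add: sum_distrib_left[symmetric] sum_subtractf m_def b_def of_bool_def sum.If_cases
          Int_def)
    finally have "c * (- 1) \<le> c * (m - 2 * real b)"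
      by simp
    then have "- 1 \<le> m - 2 * real b"
      using \<open>0 < c\<close> by (simp only: mult_le_cancel_left_pos)
    then show ?thesis
      by simp
  qed
  \<comment> \<open>A set of sum above \<open>c\<close> stays nonnegative when any outside element
    of weight at least \<open>-c\<close> is added.\<close>
  have ext: "m - t - b \<le> card {S \<in> F. T \<subseteq> S}" if "T \<in> H" for T
  proof -
    define B where "B = (A - T) - {a \<in> A. x a < - c}"
    have T: "T \<subseteq> A" "finite T" "card T = t" "c < sum x T"
      using that by (auto simp: H_def nsets_def)
    have "m - t - b \<le> card (A - T) - card {a \<in> A. x a < - c}"
      using T by (simp add: m_def b_def card_Diff_subset)
    also have "\<dots> \<le> card B"
      unfolding B_def using assms(1) by (intro diff_card_le_card_Diff) auto
    also have "\<dots> = card ((\<lambda>a. insert a T) ` B)"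
      by (intro card_image[symmetric]) (auto simp: inj_on_def B_def)
    also have "\<dots> \<le> card {S \<in> F. T \<subseteq> S}"
    proof (intro card_mono)
      show "(\<lambda>a. insert a T) ` B \<subseteq> {S \<in> F. T \<subseteq> S}"
        using T by (auto simp: F_def nonneg_nsets_def nsets_def B_def)
    qed (use fin(4) in auto)
    finally show ?thesis .
  qed
  \<comment> \<open>Pairs \<open>T \<subseteq> S\<close> are counted twice; each \<open>S\<close>
    has only \<open>t + 1\<close> subsets of size \<open>t\<close>.\<close>
  have "card H * (m - t - b) = (\<Sum>T\<in>H. m - t - b)"
    by simp
  also have "\<dots> \<le> (\<Sum>T\<in>H. card {S \<in> F. T \<subseteq> S})"
    by (intro sum_mono ext)
  also have "\<dots> = (\<Sum>S\<in>F. card {T \<in> H. T \<subseteq> S})"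
    using fin by (intro sum_multicount_gen) auto
  also have "\<dots> \<le> (\<Sum>S\<in>F. Suc t)"
  proof (intro sum_mono)
    fix S assume "S \<in> F"
    then have S: "finite S" "card S = Suc t"
      by (auto simp: F_def nonneg_nsets_def nsets_def)
    then have "card {T \<in> H. T \<subseteq> S} \<le> card ([S]\<^bsup>t\<^esup>)"
      by (intro card_mono finite_imp_finite_nsets) (auto simp: H_def nsets_def)
    then show "card {T \<in> H. T \<subseteq> S} \<le> Suc t"
      using S by simp
  qed
  finally have "card H * (m - t - b) \<le> card F * Suc t"
    by simp
  then have "real (card H) * real (m - t - b) \<le> card F * (real t + 1)"
    by (metis of_nat_Suc of_nat_le_iff of_nat_mult add.commute)
  \<comment> \<open>\<open>m - t - b\<close> is at least \<open>(m - 1) / 2 - t\<close>, and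
    \<open>m\<close> is at least \<open>8 * t^2 + 16 * t + 7\<close>.\<close>
  moreover have "real t * (4 * t + 7) \<le> real (m - t - b)"
    using m b by (simp add: algebra_simps)
  ultimately have "real (card H) * (real t * (4 * t + 7)) \<le> card F * (real t + 1)"
    by (meson mult_left_mono of_nat_0_le_iff order_trans)
  moreover have "11 * real N * (4 * t + 7) \<le> 24 * (t * real (card H)) * (4 * t + 7)"
    using H by (intro mult_right_mono) auto
  ultimately have "(44 * t + 77) * real N \<le> 24 * (real t + 1) * card F"
    by (simp add: algebra_simps)
  moreover have "24 * (real t + 1) * N < (44 * t + 77) * real N"
    using \<open>N > 0\<close> by (intro mult_strict_right_mono) auto
  ultimately have "24 * (real t + 1) * N < 24 * (real t + 1) * card F"
    by linarith
  then show ?thesis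
    by (simp add: N_def m_def F_def)
qed

section \<open>Combining the sets through and avoiding the largest element\<close>

lemma card_nonneg_nsets_insert:
  fixes x :: "'a \<Rightarrow> real"
  assumes "finite A" "a \<notin> A"
  shows "card (nonneg_nsets x (insert a A) (Suc t))
    = card {T \<in> [A]\<^bsup>t\<^esup>. - x a \<le> sum x T} + card (nonneg_nsets x A (Suc t))"
proof -
  have eq: "insert a A - {a} = A"
    using assms(2) by auto
  have sum_insert: "sum x (insert a T) = x a + sum x T" if "T \<in> [A]\<^bsup>t\<^esup>" for T
    using that assms(2) by (subst sum.insert) (auto simp: nsets_def)
  let ?G = "{T \<in> [A]\<^bsup>t\<^esup>. - x a \<le> sum x T}"
  have "nonneg_nsets x (insert a A) (Suc t) =
      {S \<in> {S \<in> [insert a A]\<^bsup>Suc t\<^esup>. a \<in> S}. 0 \<le> sum x S} \<union> nonneg_nsets x A (Suc t)"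
    using assms(2) by (auto simp: nonneg_nsets_def nsets_def)
  also have "{S \<in> {S \<in> [insert a A]\<^bsup>Suc t\<^esup>. a \<in> S}. 0 \<le> sum x S} = insert a ` ?G"
    using assms(1) by (subst nsets_containing) (auto simp: eq sum_insert)
  also have "card (insert a ` ?G \<union> nonneg_nsets x A (Suc t))
      = card (insert a ` ?G) + card (nonneg_nsets x A (Suc t))"
    using assms by (intro card_Un_disjoint)
      (auto simp: nonneg_nsets_def nsets_def finite_imp_finite_nsets)
  also have "card (insert a ` ?G) = card ?G"
    by (intro card_image inj_on_subset[OF inj_on_insert_notin]) (use assms(2) in \<open>auto simp: nsets_def\<close>)
  finally show ?thesis .
qed

theorem theorem1p4:
  fixes n k :: nat and x :: "nat \<Rightarrow> real"
  assumes "n > 0" and "k > 0"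
    and "(\<Sum>i = 1..n. x i) = 0"
    and "\<And>i j. i \<in> {1..n} \<Longrightarrow> j \<in> {1..n} \<Longrightarrow> i \<le> j \<Longrightarrow> x i \<ge> x j"
    and "n \<ge> 8 * k ^ 2"
  shows "card (nonneg_k_subsets x n k) \<ge> (n - 1) choose (k - 1) \<and>
    (card (nonneg_k_subsets x n k) = (n - 1) choose (k - 1) \<longrightarrow>
      nonneg_k_subsets x n k = {I \<in> k_subsets n k. 1 \<in> I})"
proof -
  define X where "X = {1..n}"
  define A where "A = {2..n}"
  define t where "t = k - 1"
  define N where "N = (n - 1 choose t)"
  have k: "k = Suc t"
    using \<open>k > 0\<close> by (simp add: t_def)
  have X: "finite X" "finite A" "X = insert 1 A" "1 \<notin> A" "1 \<in> X" "card X = n" "card A = n - 1"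
    using \<open>n > 0\<close> by (auto simp: X_def A_def)
  have ks: "k_subsets n k = [X]\<^bsup>k\<^esup>"
    by (auto simp: k_subsets_def nsets_def X_def intro: finite_subset)
  have nn: "nonneg_k_subsets x n k = nonneg_nsets x X k"
    by (simp add: nonneg_k_subsets_def nonneg_nsets_def ks)
  have fin: "finite (nonneg_nsets x X k)"
    using X(1) by (simp add: nonneg_nsets_def finite_imp_finite_nsets)
  define Star where "Star = {S \<in> [X]\<^bsup>k\<^esup>. 1 \<in> S}"
  have Star: "card Star = N"
    using card_nsets_containing[OF X(1,5), of t] by (simp add: Star_def k N_def X(6))
  show ?thesis
  proof (cases "Star \<subseteq> nonneg_nsets x X k")
    case True
    then have "N \<le> card (nonneg_nsets x X k)"
      using Star fin by (metis card_mono)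
    \<comment> \<open>A finite family containing \<open>Star\<close> and of the same size equals
      it.\<close>
    moreover have "nonneg_nsets x X k = Star" if "card (nonneg_nsets x X k) = N"
      using True Star fin that by (metis card_subset_eq)
    ultimately show ?thesis
      by (simp add: nn ks N_def t_def Star_def)
  next
    case False
    then obtain B where B: "B \<in> [X]\<^bsup>k\<^esup>" "1 \<in> B" "sum x B < 0"
      by (force simp: Star_def nonneg_nsets_def)
    then have B': "B \<subseteq> X" "finite B" "card B = k"
      by (auto simp: nsets_def)
    have max: "x i \<le> x 1" if "i \<in> X" for i
      using that assms(1,4) by (auto simp: X_def)
    have sumX: "sum x X = 0"
      using assms(3) by (simp add: X_def)
    then have sumA: "sum x A = - x 1"
      unfolding X(3) sum.insert[OF X(2,4)] by simp
    \<comment> \<open>Otherwise all values are nonpositive with sum zero, hence zero, and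
      \<open>B\<close> could not be negative.\<close>
    have "0 < x 1"
    proof (rule ccontr)
      assume "\<not> 0 < x 1"
      then have "\<forall>i\<in>X. x i \<le> 0"
        using max by force
      with sumX have "\<forall>i\<in>X. x i = 0"
        using X(1) sum_nonneg_eq_0_iff[of X "\<lambda>i. - x i"] by (simp add: sum_negf)
      then have "sum x B = 0"
        using B'(1) by (intro sum.neutral) auto
      with B(3) show False
        by simp
    qed
    have "t > 0"
    proof (rule ccontr)
      assume "\<not> t > 0"
      then have "B = {1}"
        using B' B(2) by (auto simp: k card_1_singleton_iff)
      with B(3) \<open>0 < x 1\<close> show False
        by simp
    qed
    define G where "G = {T \<in> [A]\<^bsup>t\<^esup>. - x 1 \<le> sum x T}"
    have total: "card (nonneg_nsets x X k) = card G + card (nonneg_nsets x A k)"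
      using card_nonneg_nsets_insert[OF X(2,4), of x t] by (simp add: X(3) k G_def)
    \<comment> \<open>Strictness makes the equality claim vacuous in this case.\<close>
    have "N < card (nonneg_nsets x X k)"
    proof (cases "4 * card G < N")
      case True
      have "8 * (t + 1)\<^sup>2 \<le> card A + 1"
        using assms(1,5) by (simp add: X(7) k)
      then have "N < card (nonneg_nsets x A k)"
        using many_nonneg_nsets[OF X(2) sumA \<open>0 < x 1\<close> _ \<open>t > 0\<close>] max True
        by (simp add: X N_def k G_def)
      then show ?thesis
        using total by simp
    next
      case False
      have "2 * k \<le> n"
        using assms(2,5) self_le_power[of k 2] by linarith
      have "0 \<le> sum x (X - B)"
        using B B' sumX X(1) by (simp add: sum_diff)
      moreover have "card (X - B) = n - k"
        using B' X by (simp add: card_Diff_subset)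
      ultimately have "(n - k - k choose (k - 1)) \<le> card (nonneg_nsets x (X - B) k)"
        using card_nonneg_nsets_ge[of "X - B" x k] X(1) \<open>2 * k \<le> n\<close> \<open>k > 0\<close> by simp
      \<comment> \<open>As \<open>1 \<in> B\<close>, sets inside \<open>X - B\<close> avoid the
        index 1 and are disjoint from those counted by \<open>G\<close>.\<close>
      also have "\<dots> \<le> card (nonneg_nsets x A k)"
        using X B(2)
        by (intro card_mono) (auto simp: nonneg_nsets_def nsets_def finite_imp_finite_nsets)
      finally have "3 * N < 4 * card (nonneg_nsets x A k)"
        using binomial_shift_lower_bound[OF assms(2,5)] by (simp add: N_def t_def mult_2)
      with False show ?thesis
        using total by linarith
    qed
    then show ?thesis
      by (simp add: nn N_def t_def)
  qed
qed

end
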